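(* Fix $\tau$ with $\tfrac{1}{\sqrt2}+\tfrac12\le\tau<\tfrac32$. Let $S_Q^{(\tau)}$ denote the maximal quantum value of the Bell expression $S^{(\tau)}$, i.e. the supremum of $S^{(\tau)}$ over all bipartite quantum states $\rho$ of arbitrary finite local dimension and all local two-outcome measurements $\{A_x^a\}_{a=0,1}$ ($x=0,1$) for Alice and $\{B_y^b\}_{b=0,1}$ ($y=0,1$) for Bob, where $p(a,b|x,y)=\mathrm{tr}(\rho\,A_x^a\otimes B_y^b)$. Then for no finite $d$ does there exist a choice of local measurements such that the maximally entangled state $|\Psi_d^+\rangle=\frac{1}{\sqrt d}\sum_{j=1}^d|j\rangle_A|j\rangle_B$ attains $S^{(\tau)}=S_Q^{(\tau)}$; that is, no finite-dimensional maximally entangled state violates the inequality $S^{(\tau)}\le 0$ maximally.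
   Context: Two parties, Alice and Bob, each choose one of two measurements ($x\in\{0,1\}$ for Alice, $y\in\{0,1\}$ for Bob) with outcomes $a,b\in\{0,1\}$; $p(a,b|x,y)$ is the joint probability of outcomes $a,b$ given settings $x,y$, and $p_A(a|x)$, $p_B(b|y)$ are the marginals. For a real parameter $\tau\ge1$ the Bell expression is $S^{(\tau)}=\sum_{x,y,a,b\in\{0,1\}}\beta_{xy}^{ab}\,p(a,b|x,y)$ with $\beta_{01}^{00}=\beta_{10}^{00}=1-\tau$, $\beta_{01}^{01}=\beta_{10}^{10}=-\tau$, $\beta_{00}^{00}=1$, $\beta_{11}^{00}=-1$, and all other $\beta_{xy}^{ab}=0$. Explicitly, $S^{(\tau)}=p(0,0|0,0)-p(0,0|1,1)+(1-\tau)[p(0,0|0,1)+p(0,0|1,0)]-\tau[p(0,1|0,1)+p(1,0|1,0)]$. Separable states satisfy $S^{(\tau)}\le0$ (the Bell inequality $I^{(\tau)}$); for $\tau=1$ it is the Clauser–Horne inequality. "Violating maximally" means achieving the maximal quantum value $S_Q^{(\tau)}$ (which is strictly positive for $1\le\tau<3/2$). *)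

theory Defs
  imports Complex_Main "Jordan_Normal_Form.Matrix"
begin

definition mtrace :: "complex mat \<Rightarrow> complex" where
  "mtrace A = (\<Sum>i<dim_row A. A $$ (i, i))"

definition psd :: "nat \<Rightarrow> complex mat \<Rightarrow> bool" where
  "psd n A \<longleftrightarrow> A \<in> carrier_mat n n \<and>
     (\<forall>v \<in> carrier_vec n.
        let q = (\<Sum>i<n. \<Sum>j<n. cnj (v $ i) * A $$ (i, j) * v $ j) in Im q = 0 \<and> 0 \<le> Re q)"

definition density :: "nat \<Rightarrow> complex mat \<Rightarrow> bool" where
  "density n \<rho> \<longleftrightarrow> psd n \<rho> \<and> mtrace \<rho> = 1"

definition povm2 :: "nat \<Rightarrow> (nat \<Rightarrow> complex mat) \<Rightarrow> bool" where
  "povm2 n M \<longleftrightarrow> psd n (M 0) \<and> psd n (M 1) \<and> M 0 + M 1 = 1\<^sub>m n"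

text \<open>Kronecker (tensor) product; index (i,k) of C^n (x) C^m is i*m+k.\<close>
definition tensor :: "complex mat \<Rightarrow> complex mat \<Rightarrow> complex mat" where
  "tensor A B = mat (dim_row A * dim_row B) (dim_col A * dim_col B)
     (\<lambda>(i, j). A $$ (i div dim_row B, j div dim_col B) * B $$ (i mod dim_row B, j mod dim_col B))"

text \<open>Behaviour p(a,b|x,y) = tr(rho (A_x^a (x) B_y^b)), written p a b x y.
  A x a is Alice's effect for setting x and outcome a; similarly for B.\<close>
definition qprob :: "complex mat \<Rightarrow> (nat \<Rightarrow> nat \<Rightarrow> complex mat) \<Rightarrow> (nat \<Rightarrow> nat \<Rightarrow> complex mat)
    \<Rightarrow> nat \<Rightarrow> nat \<Rightarrow> nat \<Rightarrow> nat \<Rightarrow> real" where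
  "qprob \<rho> A B a b x y = Re (mtrace (\<rho> * tensor (A x a) (B y b)))"

definition bellS :: "real \<Rightarrow> (nat \<Rightarrow> nat \<Rightarrow> nat \<Rightarrow> nat \<Rightarrow> real) \<Rightarrow> real" where
  "bellS \<tau> p = p 0 0 0 0 - p 0 0 1 1 + (1 - \<tau>) * (p 0 0 0 1 + p 0 0 1 0)
                - \<tau> * (p 0 1 0 1 + p 1 0 1 0)"

definition quantum_values :: "real \<Rightarrow> real set" where
  "quantum_values \<tau> = {bellS \<tau> (qprob \<rho> A B) | dA dB \<rho> A B.
      0 < dA \<and> 0 < dB \<and> density (dA * dB) \<rho> \<and>
      povm2 dA (A 0) \<and> povm2 dA (A 1) \<and> povm2 dB (B 0) \<and> povm2 dB (B 1)}"

definition SQ :: "real \<Rightarrow> real" where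
  "SQ \<tau> = Sup (quantum_values \<tau>)"

definition maxent_vec :: "nat \<Rightarrow> complex vec" where
  "maxent_vec d = vec (d * d) (\<lambda>k. if k div d = k mod d then complex_of_real (1 / sqrt (real d)) else 0)"

definition maxent_rho :: "nat \<Rightarrow> complex mat" where
  "maxent_rho d = mat (d * d) (d * d) (\<lambda>(i, j). maxent_vec d $ i * cnj (maxent_vec d $ j))"

end

theory Submission
  imports Defs "HOL-Library.Function_Algebras" "Jordan_Normal_Form.Schur_Decomposition"
begin

text \<open>
  With \<open>b = 1 - a\<close> eliminated, \<open>S = A0 B0 + A0 B1 + A1 B0 - A1 B1 - \<tau> (A0 + B0)\<close>, and in the maximally
  entangled state \<open>A \<otimes> B\<close> has expectation \<open>tr (A B\<^sup>T) / d\<close>.  For effects \<open>E, P, Q\<close> one has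
  \<open>\<surd>2 tr (E (P - Q)) \<le> 3/2 tr P - tr (P Q)\<close>.  By symmetry assume \<open>tr A0 \<le> tr B0\<close>; adding the instances
  \<open>(B1, A0, A1)\<close> and \<open>(B0, A0, 1 - A1)\<close>, the terms \<open>tr (A0 A1)\<close> cancel and \<open>S \<le> 0\<close> follows as soon as
  \<open>2 \<tau> \<ge> \<surd>2 + 1\<close>.  On the other hand the state \<open>|11> - tan\<^sup>2 \<phi> |00>\<close>, with \<open>A0 = B0 = |0><0|\<close> and
  \<open>A1 = B1\<close> the projection onto \<open>cos \<phi> |0> + sin \<phi> |1>\<close>, is orthogonal to the product vector of \<open>A1 B1\<close> and
  makes \<open>S\<close> a positive multiple of \<open>1 + 2 cos\<^sup>2 \<phi> - 2 \<tau>\<close>, which is positive for small \<open>\<phi>\<close> when \<open>\<tau> < 3/2\<close>.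
\<close>

section \<open>Positive matrices as sesquilinear forms\<close>

text \<open>Vectors and matrices are functions of their indices, of which only those below \<open>n\<close> matter.\<close>

definition cinner :: "nat \<Rightarrow> (nat \<Rightarrow> complex) \<Rightarrow> (nat \<Rightarrow> complex) \<Rightarrow> complex" where
  "cinner n v w = (\<Sum>i<n. cnj (v i) * w i)"

definition mapp :: "nat \<Rightarrow> (nat \<Rightarrow> nat \<Rightarrow> complex) \<Rightarrow> (nat \<Rightarrow> complex) \<Rightarrow> nat \<Rightarrow> complex" where
  "mapp n A v = (\<lambda>i. \<Sum>j<n. A i j * v j)"

definition sesq :: "nat \<Rightarrow> (nat \<Rightarrow> nat \<Rightarrow> complex) \<Rightarrow> (nat \<Rightarrow> complex) \<Rightarrow> (nat \<Rightarrow> complex) \<Rightarrow> complex" where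
  "sesq n A v w = (\<Sum>i<n. \<Sum>j<n. cnj (v i) * A i j * w j)"

definition pos :: "nat \<Rightarrow> (nat \<Rightarrow> nat \<Rightarrow> complex) \<Rightarrow> bool" where
  "pos n A \<longleftrightarrow> (\<forall>v. Im (sesq n A v v) = 0 \<and> 0 \<le> Re (sesq n A v v))"

definition idm :: "nat \<Rightarrow> nat \<Rightarrow> complex" where
  "idm i j = (if i = j then 1 else 0)"

definition outer :: "(nat \<Rightarrow> complex) \<Rightarrow> nat \<Rightarrow> nat \<Rightarrow> complex" where
  "outer v i j = v i * cnj (v j)"

text \<open>The trace of the product \<open>A B\<close>; the trace of \<open>A\<close> itself
  appears as \<open>trp n A idm\<close>.\<close>

definition trp :: "nat \<Rightarrow> (nat \<Rightarrow> nat \<Rightarrow> complex) \<Rightarrow> (nat \<Rightarrow> nat \<Rightarrow> complex) \<Rightarrow> complex" where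
  "trp n A B = (\<Sum>i<n. \<Sum>j<n. A i j * B j i)"

definition effect :: "nat \<Rightarrow> (nat \<Rightarrow> nat \<Rightarrow> complex) \<Rightarrow> bool" where
  "effect n A \<longleftrightarrow> pos n A \<and> pos n (idm - A)"

section \<open>Sesquilinear forms, positivity and the Cauchy-Schwarz inequality\<close>

lemma sesq_mapp: "sesq n A v w = cinner n v (mapp n A w)"
  by (simp add: sesq_def cinner_def mapp_def sum_distrib_left mult.assoc)

lemma sesq_add_left: "sesq n A (\<lambda>i. u i + v i) w = sesq n A u w + sesq n A v w"
  by (simp add: sesq_def algebra_simps sum.distrib)

lemma sesq_add_right: "sesq n A u (\<lambda>i. v i + w i) = sesq n A u v + sesq n A u w"
  by (simp add: sesq_def algebra_simps sum.distrib)

lemma sesq_scale_left: "sesq n A (\<lambda>i. c * v i) w = cnj c * sesq n A v w"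
  by (simp add: sesq_def sum_distrib_left mult_ac)

lemma sesq_scale_right: "sesq n A v (\<lambda>i. c * w i) = c * sesq n A v w"
  by (simp add: sesq_def sum_distrib_left mult_ac)

lemma sesq_expand:
  "sesq n A (\<lambda>i. v i + c * w i) (\<lambda>i. v i + c * w i) =
    sesq n A v v + c * sesq n A v w + cnj c * sesq n A w v + cnj c * c * sesq n A w w"
  by (simp add: sesq_add_left sesq_add_right sesq_scale_left sesq_scale_right algebra_simps)

lemma sesq_diff_mat: "sesq n (A - B) v w = sesq n A v w - sesq n B v w"
  by (simp add: sesq_def algebra_simps sum_subtractf)

lemma sesq_add_mat: "sesq n (A + B) v w = sesq n A v w + sesq n B v w"
  by (simp add: sesq_def algebra_simps sum.distrib)

lemma sesq_smult_mat: "sesq n (\<lambda>i j. c * A i j) v w = c * sesq n A v w"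
  by (simp add: sesq_def sum_distrib_left mult_ac)

lemma sesq_outer: "sesq n (outer p) v w = cinner n v p * cinner n p w"
  by (simp add: sesq_def cinner_def outer_def sum_product mult_ac)

lemma sesq_idm: "sesq n idm v w = cinner n v w"
  unfolding sesq_mapp by (simp add: cinner_def mapp_def idm_def if_distrib[where f="\<lambda>x. x * _"] cong: if_cong)

lemma cnj_cinner: "cnj (cinner n v w) = cinner n w v"
  by (simp add: cinner_def mult.commute)

lemma pos_idm: "pos n idm"
proof -
  have "cinner n v v = of_real (\<Sum>i<n. (cmod (v i))\<^sup>2)" for v
    unfolding cinner_def of_real_sum by (intro sum.cong refl) (metis complex_norm_square mult.commute)
  then show ?thesis by (simp add: pos_def sesq_idm sum_nonneg)
qed

lemma pos_add: "pos n A \<Longrightarrow> pos n B \<Longrightarrow> pos n (A + B)"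
  by (simp add: pos_def sesq_add_mat)

lemma pos_outer: "pos n (outer p)"
proof -
  have "sesq n (outer p) v v = of_real ((cmod (cinner n v p))\<^sup>2)" for v
    by (metis sesq_outer cnj_cinner complex_norm_square)
  then show ?thesis by (simp add: pos_def)
qed

lemma pos_real: "pos n A \<Longrightarrow> sesq n A v v = of_real (Re (sesq n A v v))"
  by (simp add: pos_def complex_eq_iff)

text \<open>\<open>pos\<close> only asks for a real quadratic form; polarization with the
  coefficients 1 and \<open>\<i>\<close> recovers Hermitian symmetry.\<close>

lemma pos_hermitian:
  assumes "pos n A"
  shows "sesq n A w v = cnj (sesq n A v w)"
proof -
  have "Im (sesq n A (\<lambda>i. v i + c * w i) (\<lambda>i. v i + c * w i)) = 0" "Im (sesq n A v v) = 0" "Im (sesq n A w w) = 0" for c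
    using assms by (auto simp: pos_def)
  note this(1)[unfolded sesq_expand] this(2,3)
  from this(1)[of 1] this(1)[of \<i>] this(2,3) show ?thesis
    by (simp add: complex_eq_iff)
qed

lemma pos_Cauchy_Schwarz:
  assumes "pos n A"
  shows "(cmod (sesq n A v w))\<^sup>2 \<le> Re (sesq n A v v) * Re (sesq n A w w)"
proof -
  define a where "a = Re (sesq n A v v)"
  define b where "b = Re (sesq n A w w)"
  define z where "z = sesq n A v w"
  have a: "sesq n A v v = of_real a" and b: "sesq n A w w = of_real b"
    unfolding a_def b_def by (rule pos_real[OF assms])+
  have b0: "b \<ge> 0" using assms by (simp add: b_def pos_def)
  have wv: "sesq n A w v = cnj z" unfolding z_def by (rule pos_hermitian[OF assms])
  \<comment> \<open>The form at \<open>v - t * cnj z * w\<close> with \<open>t\<close> real: the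
    factor \<open>cnj z\<close> cancels the phase of the cross term and leaves a real quadratic in
    \<open>t\<close>, minimal at \<open>t = 1 / b\<close> if \<open>b > 0\<close> and
    \<open>z\<close> is nonzero.\<close>
  have key: "0 \<le> a - 2 * t * (cmod z)\<^sup>2 + t\<^sup>2 * (cmod z)\<^sup>2 * b" for t
  proof -
    have "0 \<le> Re (sesq n A (\<lambda>i. v i + (- of_real t * cnj z) * w i) (\<lambda>i. v i + (- of_real t * cnj z) * w i))"
      using assms by (simp only: pos_def)
    also have "\<dots> = a - 2 * t * (cmod z)\<^sup>2 + t\<^sup>2 * (cmod z)\<^sup>2 * b"
    proof -
      have "z * cnj z = of_real (cmod z) * of_real (cmod z)"
        by (metis complex_norm_square of_real_power power2_eq_square)
      then have "(- of_real t * cnj z) * z = of_real (- t * (cmod z)\<^sup>2)"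
        and "cnj (- of_real t * cnj z) * cnj z = of_real (- t * (cmod z)\<^sup>2)"
        and "cnj (- of_real t * cnj z) * (- of_real t * cnj z) * of_real b = of_real (t\<^sup>2 * (cmod z)\<^sup>2 * b)"
        by (simp_all add: power2_eq_square mult_ac)
      then show ?thesis
        unfolding sesq_expand a b wv z_def[symmetric] by (simp only: plus_complex.sel Re_complex_of_real)
    qed
    finally show ?thesis .
  qed
  show ?thesis unfolding a_def[symmetric] b_def[symmetric] z_def[symmetric]
  proof (cases "b = 0")
    case False
    then have "b > 0" using b0 by simp
    then have "a - 2 * (1 / b) * (cmod z)\<^sup>2 + (1 / b)\<^sup>2 * (cmod z)\<^sup>2 * b = a - (cmod z)\<^sup>2 / b"
      by (simp add: power2_eq_square)
    with key[of "1 / b"] have "(cmod z)\<^sup>2 / b \<le> a" by simp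
    with \<open>b > 0\<close> show "(cmod z)\<^sup>2 \<le> a * b" by (simp add: divide_le_eq)
  next
    case True
    have "(cmod z)\<^sup>2 = 0"
    proof (rule ccontr)
      assume "(cmod z)\<^sup>2 \<noteq> 0"
      \<comment> \<open>For \<open>b = 0\<close> the bound \<open>key\<close> is affine in
        \<open>t\<close>; this \<open>t\<close> would bring it down to -1.\<close>
      then have "2 * ((a + 1) / (2 * (cmod z)\<^sup>2)) * (cmod z)\<^sup>2 = a + 1" by simp
      then show False using key[of "(a + 1) / (2 * (cmod z)\<^sup>2)"] True by simp
    qed
    with True show "(cmod z)\<^sup>2 \<le> a * b" by simp
  qed
qed

lemma pos_null:
  assumes "pos n A" "sesq n A p p = 0"
  shows "sesq n A v p = 0"
  using pos_Cauchy_Schwarz[OF assms(1), of v p] assms(2) by simp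

text \<open>Cauchy-Schwarz bounds the squared modulus of \<open>sesq n A v w\<close> by the form at
  \<open>v\<close> times the form at \<open>w\<close>, and the latter is at most 1. Both the
  Cholesky step and the removal of eigenvectors from effects rest on this.\<close>

lemma pos_deflate:
  assumes A: "pos n A" and r: "Re (sesq n A w w) \<le> 1"
  shows "pos n (A - outer (mapp n A w))"
  unfolding pos_def
proof
  fix v
  have "sesq n (outer (mapp n A w)) v v = of_real ((cmod (sesq n A v w))\<^sup>2)"
    by (simp only: sesq_outer sesq_mapp[of n A] complex_norm_square cnj_cinner)
  moreover have "(cmod (sesq n A v w))\<^sup>2 \<le> Re (sesq n A v v) * 1"
    using A r by (intro order_trans[OF pos_Cauchy_Schwarz[OF A, of v w]] mult_left_mono) (simp_all add: pos_def)
  ultimately show "Im (sesq n (A - outer (mapp n A w)) v v) = 0 \<and> 0 \<le> Re (sesq n (A - outer (mapp n A w)) v v)"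
    using A[unfolded pos_def, THEN spec, of v] by (simp add: sesq_diff_mat)
qed

section \<open>The trace pairing and decomposition into rank-one matrices\<close>

lemma trp_diff_left: "trp n (A - B) C = trp n A C - trp n B C"
  by (simp add: trp_def algebra_simps sum_subtractf)

lemma trp_commute: "trp n A B = trp n B A"
  unfolding trp_def by (subst sum.swap) (simp add: mult.commute)

lemma trp_diff_right: "trp n C (A - B) = trp n C A - trp n C B"
  by (metis trp_diff_left trp_commute)

lemma trp_outer: "trp n (outer p) B = sesq n B p p"
  unfolding trp_def sesq_def outer_def by (subst sum.swap) (simp add: mult_ac)

lemma trp_cong:
  "(\<And>i j. i < n \<Longrightarrow> j < n \<Longrightarrow> A i j = A' i j) \<Longrightarrow> (\<And>i j. i < n \<Longrightarrow> j < n \<Longrightarrow> B i j = B' i j)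
    \<Longrightarrow> trp n A B = trp n A' B'"
  by (simp add: trp_def)

definition unitv :: "nat \<Rightarrow> nat \<Rightarrow> complex" where
  "unitv k i = (if i = k then 1 else 0)"

lemma mapp_unitv: "k < n \<Longrightarrow> mapp n A (unitv k) i = A i k"
  by (simp add: mapp_def unitv_def if_distrib[where f="\<lambda>x. _ * x"] cong: if_cong)

lemma sesq_unitv: "i < n \<Longrightarrow> j < n \<Longrightarrow> sesq n A (unitv i) (unitv j) = A i j"
  by (simp add: sesq_mapp mapp_unitv cinner_def unitv_def if_distrib[where f=cnj] if_distrib[where f="\<lambda>x. x * _"] cong: if_cong)

lemma pos_zero_diag:
  assumes "pos n A" "i < n" "j < n" "A j j = 0"
  shows "A i j = 0"
  using pos_null[OF assms(1), of "unitv j" "unitv i"] assms by (simp add: sesq_unitv)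

lemma pos_entry_cnj: "pos n A \<Longrightarrow> i < n \<Longrightarrow> j < n \<Longrightarrow> A i j = cnj (A j i)"
  using pos_hermitian[of n A "unitv i" "unitv j"] by (simp add: sesq_unitv)

text \<open>Cholesky decomposition: each step clears one diagonal entry.\<close>

lemma pos_sum_outer:
  assumes "pos n A"
  shows "\<exists>m::nat. \<exists>vs. \<forall>i<n. \<forall>j<n. A i j = (\<Sum>k<m. outer (vs k) i j)"
  using assms
proof (induction "card {i. i < n \<and> A i i \<noteq> 0}" arbitrary: A rule: less_induct)
  case less
  show ?case
  proof (cases "\<forall>i<n. A i i = 0")
    case True
    then have "\<forall>i<n. \<forall>j<n. A i j = 0"
      using pos_zero_diag[OF less.prems] by blast
    then show ?thesis by (intro exI[of _ "0::nat"]) simp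
  next
    case False
    then obtain l where l: "l < n" "A l l \<noteq> 0" by blast
    define r where "r = Re (A l l)"
    have Al: "A l l = of_real r"
      using pos_real[OF less.prems, of "unitv l"] l by (simp add: r_def sesq_unitv)
    have "r \<ge> 0"
      using less.prems[unfolded pos_def, THEN spec, of "unitv l"] l by (simp add: r_def sesq_unitv)
    with l Al have r: "r > 0" by (cases "r = 0") auto
    \<comment> \<open>Scaled so that the form at \<open>w\<close> equals 1; subtracting
      \<open>outer p\<close> then clears the entry \<open>(l, l)\<close> exactly.\<close>
    define w where "w = (\<lambda>i. complex_of_real (1 / sqrt r) * unitv l i)"
    define p where "p = mapp n A w"
    have p: "p i = A i l / of_real (sqrt r)" for i
      using l by (simp add: p_def w_def mapp_def unitv_def if_distrib[where f="\<lambda>x. _ * x"] cong: if_cong)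
    have "sesq n A w w = 1"
    proof -
      have "sesq n A w w = cnj (complex_of_real (1 / sqrt r)) * (complex_of_real (1 / sqrt r) * sesq n A (unitv l) (unitv l))"
        unfolding w_def sesq_scale_left sesq_scale_right ..
      also have "\<dots> = of_real (1 / sqrt r * (1 / sqrt r * r))"
        using l by (simp only: sesq_unitv Al of_real_mult complex_cnj_complex_of_real)
      also have "1 / sqrt r * (1 / sqrt r * r) = 1" using r by (simp add: field_simps)
      finally show ?thesis by simp
    qed
    then have pos': "pos n (A - outer p)" unfolding p_def by (intro pos_deflate less.prems) simp
    have pl: "p l = of_real (sqrt r)"
      unfolding p Al of_real_divide[symmetric] using r by (simp add: real_div_sqrt)
    have "complex_of_real (sqrt r) * complex_of_real (sqrt r) = complex_of_real (sqrt r * sqrt r)"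
      by (rule of_real_mult[symmetric])
    also have "sqrt r * sqrt r = r" using r by simp
    finally have ll: "(A - outer p) l l = 0"
      unfolding fun_diff_def outer_def pl Al complex_cnj_complex_of_real by (rule right_minus_eq[THEN iffD2, OF sym])
    \<comment> \<open>Diagonal entries that are already zero stay zero: positivity makes the whole
      row and column vanish, hence also \<open>p i\<close>. So the count of nonzero entries strictly
      drops.\<close>
    have z: "A i i = 0 \<Longrightarrow> (A - outer p) i i = 0" if "i < n" for i
    proof -
      assume "A i i = 0"
      then have "A l i = 0" using pos_zero_diag[OF less.prems l(1) that] by simp
      then have "A i l = 0" using pos_entry_cnj[OF less.prems that l(1)] by simp
      with \<open>A i i = 0\<close> show ?thesis by (simp add: outer_def p)
    qed
    have "{i. i < n \<and> (A - outer p) i i \<noteq> 0} \<subset> {i. i < n \<and> A i i \<noteq> 0}"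
      using ll l z by blast
    then have "card {i. i < n \<and> (A - outer p) i i \<noteq> 0} < card {i. i < n \<and> A i i \<noteq> 0}"
      by (intro psubset_card_mono) auto
    from less.hyps[OF this pos'] obtain m :: nat and vs
      where vs: "\<forall>i<n. \<forall>j<n. (A - outer p) i j = (\<Sum>k<m. outer (vs k) i j)" by blast
    have "\<forall>i<n. \<forall>j<n. A i j = (\<Sum>k<Suc m. outer ((vs(m := p)) k) i j)"
      using vs by (auto simp: algebra_simps)
    then show ?thesis by blast
  qed
qed

text \<open>Writing \<open>A\<close> as a sum of rank-one matrices turns the trace into a sum of
  values of the form of \<open>B\<close>.\<close>

lemma trp_nonneg:
  assumes A: "pos n A" and B: "pos n B"
  shows "0 \<le> Re (trp n A B)" and "Im (trp n A B) = 0"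
proof -
  obtain m :: nat and vs where vs: "\<forall>i<n. \<forall>j<n. A i j = (\<Sum>k<m. outer (vs k) i j)"
    using pos_sum_outer[OF A] by blast
  have "trp n A B = (\<Sum>i<n. \<Sum>j<n. \<Sum>k<m. outer (vs k) i j * B j i)"
    using vs by (simp add: trp_def sum_distrib_right)
  also have "\<dots> = (\<Sum>k<m. trp n (outer (vs k)) B)"
    unfolding trp_def by (subst sum.swap[of _ "{..<m}"], subst sum.swap[of _ "{..<m}"]) (rule refl)
  finally have "trp n A B = (\<Sum>k<m. sesq n B (vs k) (vs k))" by (simp add: trp_outer)
  then show "0 \<le> Re (trp n A B)" "Im (trp n A B) = 0"
    using B by (simp_all add: pos_def sum_nonneg)
qed

section \<open>The two-projection inequality\<close>

lemma pos_combination: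
  assumes "pos n A"
  shows "0 \<le> s\<^sup>2 * Re (sesq n A v v) + 2 * s * t * Re (sesq n A v w) + t\<^sup>2 * Re (sesq n A w w)"
proof -
  let ?u = "\<lambda>i. of_real s * v i + of_real t * w i"
  have "sesq n A w v = cnj (sesq n A v w)" by (rule pos_hermitian[OF assms])
  moreover have "0 \<le> Re (sesq n A ?u ?u)" using assms by (simp only: pos_def)
  ultimately show ?thesis
    by (simp add: sesq_add_left sesq_add_right sesq_scale_left sesq_scale_right power2_eq_square algebra_simps)
qed

lemma effect_le_cinner: "effect n E \<Longrightarrow> Re (sesq n E v v) \<le> Re (cinner n v v)"
  unfolding effect_def pos_def sesq_diff_mat sesq_idm by (metis diff_ge_0_iff_ge minus_complex.sel(1))

text \<open>This controls one deflation step: when \<open>outer p\<close> leaves \<open>P\<close>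
  and \<open>outer y\<close> leaves \<open>Q\<close>, the trace of \<open>P\<close> drops by
  \<open>a\<close> and that of \<open>P Q\<close> by \<open>m\<close>. The bound says that the slack
  of the trace inequality does not grow.\<close>

lemma effect_expectation_gap:
  fixes a m :: real
  assumes E: "effect n E"
    and pp: "cinner n p p = of_real a" and py: "cinner n p y = of_real (sqrt m)"
    and yy: "Re (cinner n y y) \<le> 1"
    and m: "0 < m" "m \<le> a" "a \<le> 1"
  shows "sqrt 2 * (Re (sesq n E p p) - Re (sesq n E y y)) \<le> 3 / 2 * a - m"
proof -
  define s :: real where "s = sqrt 2"
  have s2: "s * s = 2" by (simp add: s_def)
  have s: "7 / 5 < s" "s < 3 / 2"
    unfolding s_def by (rule real_less_rsqrt real_less_lsqrt; simp add: power2_eq_square)+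
  \<comment> \<open>In the extremal case \<open>m = a / 2\<close>, \<open>a = 1\<close>, the optimal \<open>E\<close> is the projection onto \<open>p - k r y\<close>.\<close>
  define k where "k = 2 - s"
  define r where "r = sqrt m"
  have r2: "r * r = m" using m by (simp add: r_def)
  have k2: "k\<^sup>2 = 6 - 4 * s" unfolding k_def using s2 by (simp add: power2_eq_square algebra_simps)
  define ep where "ep = Re (sesq n E p p)"
  define ey where "ey = Re (sesq n E y y)"
  define R where "R = Re (sesq n E p y)"
  have posE: "pos n E" "pos n (idm - E)" using E by (auto simp: effect_def)
  have ey: "0 \<le> ey" using posE by (simp add: ey_def pos_def)
  \<comment> \<open>Positivity of \<open>E\<close> at \<open>k r p - a y\<close>. Next, positivity
    of \<open>1 - E\<close> at \<open>p - k r y\<close>; weighted by \<open>a\<close>, the second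
    has the same cross term \<open>R\<close>, which then cancels.\<close>
  have A: "0 \<le> k\<^sup>2 * m * ep - 2 * k * r * a * R + a\<^sup>2 * ey"
    using pos_combination[OF posE(1), of "k * r" p "- a" y]
    by (simp add: ep_def ey_def R_def power_mult_distrib power2_eq_square[of r] r2)
  have "0 \<le> (a - ep) - 2 * k * r * (r - R) + k\<^sup>2 * m * (Re (cinner n y y) - ey)"
    using pos_combination[OF posE(2), of 1 p "- k * r" y]
    by (simp add: sesq_diff_mat sesq_idm pp py ep_def ey_def R_def r_def[symmetric] power_mult_distrib power2_eq_square[of r] r2)
  moreover have "k\<^sup>2 * m * Re (cinner n y y) \<le> k\<^sup>2 * m * 1"
    using yy m by (intro mult_left_mono) auto
  moreover have "2 * k * r * (r - R) = 2 * k * m - 2 * k * r * R"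
    by (simp only: right_diff_distrib mult.assoc r2)
  ultimately have B: "ep - 2 * k * r * R + k\<^sup>2 * m * ey \<le> a - 2 * k * m + k\<^sup>2 * m"
    by (simp only: right_diff_distrib mult_1_right)
  have "a * (ep - 2 * k * r * R + k\<^sup>2 * m * ey) \<le> a * (a - 2 * k * m + k\<^sup>2 * m)"
    using B m by (intro mult_left_mono) auto
  with A have "(a - k\<^sup>2 * m) * (ep - a * ey) \<le> a * (a - 2 * k * m + k\<^sup>2 * m)"
    by (simp add: algebra_simps power2_eq_square)
  then have "s * ((a - k\<^sup>2 * m) * (ep - a * ey)) \<le> s * (a * (a - 2 * k * m + k\<^sup>2 * m))"
    using s by (intro mult_left_mono) auto
  also have "\<dots> \<le> (3 / 2 * a - m) * (a - k\<^sup>2 * m)"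
  proof -
    have c: "s * (2 * k - k\<^sup>2) = 4 - 2 * s"
      unfolding k2 unfolding k_def using s2 by (simp add: algebra_simps)
    have *: "s * (a * (a - 2 * k * m + k\<^sup>2 * m)) = s * a\<^sup>2 - (4 - 2 * s) * a * m"
    proof -
      have "s * (a * (a - 2 * k * m + k\<^sup>2 * m)) = s * a\<^sup>2 - s * (2 * k - k\<^sup>2) * (a * m)"
        by (simp add: algebra_simps power2_eq_square)
      then show ?thesis unfolding c by simp
    qed
    \<comment> \<open>This value of \<open>k\<close> makes the slack a multiple of a perfect square,
      zero at \<open>m = a / 2\<close>; the factor is positive because
      \<open>s < 3 / 2\<close>.\<close>
    have "(3 / 2 * a - m) * (a - k\<^sup>2 * m) - (s * a\<^sup>2 - (4 - 2 * s) * a * m) = (6 - 4 * s) * (m - a / 2)\<^sup>2"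
      unfolding k2 by (simp add: algebra_simps power2_eq_square)
    moreover have "0 \<le> (6 - 4 * s) * (m - a / 2)\<^sup>2" using s by simp
    ultimately show ?thesis using * by linarith
  qed
  finally have "(s * (ep - a * ey)) * (a - k\<^sup>2 * m) \<le> (3 / 2 * a - m) * (a - k\<^sup>2 * m)"
    by (simp add: mult_ac)
  moreover have "0 < a - k\<^sup>2 * m"
  proof -
    have "k\<^sup>2 * m < 1 * m" using m s by (intro mult_strict_right_mono) (auto simp: k2)
    then show ?thesis using m by linarith
  qed
  ultimately have "s * (ep - a * ey) \<le> 3 / 2 * a - m" by simp
  \<comment> \<open>The vector \<open>y\<close> was weighted by \<open>a\<close>; since
    \<open>a \<le> 1\<close>, full weight only strengthens the subtraction.\<close>
  moreover have "s * (a * ey) \<le> s * ey"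
    using s ey m by (intro mult_left_mono mult_left_le_one_le) auto
  ultimately show ?thesis unfolding s_def[symmetric] ep_def[symmetric] ey_def[symmetric]
    by (simp add: algebra_simps)
qed

section \<open>An eigenvector of a product of positive matrices\<close>

lemma mtrace_mult:
  assumes "A \<in> carrier_mat n n" "B \<in> carrier_mat n n"
  shows "mtrace (A * B) = trp n (\<lambda>i j. A $$ (i, j)) (\<lambda>i j. B $$ (i, j))"
  using assms by (auto simp: mtrace_def trp_def scalar_prod_def atLeast0LessThan intro!: sum.cong)

text \<open>The trace is the sum of \<open>n\<close> eigenvalues, read off the diagonal of a Schur
  form, so one of them has at least the average modulus.\<close>

lemma large_eigenvalue:
  fixes A :: "complex mat"
  assumes A: "A \<in> carrier_mat n n" and n: "0 < n"
  shows "\<exists>e v. eigenvector A v e \<and> cmod (mtrace A) \<le> real n * cmod e"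
proof -
  obtain es where es: "char_poly A = (\<Prod>a\<leftarrow>es. [:- a, 1:])" "length es = n"
    using char_poly_factorized[OF A] by blast
  obtain B P Q where sd: "schur_decomposition A es = (B, P, Q)" by (metis prod_cases3)
  from schur_decomposition[OF A es(1) sd]
  have wit: "similar_mat_wit A B P Q" and diag: "diag_mat B = es" by auto
  note w = similar_mat_witD2[OF A wit]
  have PB: "P * B \<in> carrier_mat n n" using w by auto
  have "mtrace A = mtrace (P * B * Q)" using w(3) by simp
  also have "\<dots> = mtrace (Q * (P * B))"
    unfolding mtrace_mult[OF PB w(7)] mtrace_mult[OF w(7) PB] by (rule trp_commute)
  also have "Q * (P * B) = (Q * P) * B" using w by (metis assoc_mult_mat)
  also have "\<dots> = B" unfolding w(2) using w(5) by simp
  also have "mtrace B = sum_list es"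
    unfolding diag[symmetric] diag_mat_def mtrace_def by (simp add: interv_sum_list_conv_sum_set_nat atLeast0LessThan)
  finally have tr: "mtrace A = sum_list es" .
  have "\<exists>e\<in>set es. cmod (mtrace A) \<le> real n * cmod e"
  proof (rule ccontr)
    assume "\<not> ?thesis"
    then have *: "\<And>e. e \<in> set es \<Longrightarrow> cmod e < cmod (mtrace A) / n"
      using n by (force simp: field_simps)
    have "cmod (sum_list es) \<le> (\<Sum>e\<leftarrow>es. cmod e)"
      by (induction es) (auto intro: order_trans[OF norm_triangle_ineq])
    also have "\<dots> < (\<Sum>e\<leftarrow>es. cmod (mtrace A) / n)"
      using * es(2) n by (intro sum_list_strict_mono) auto
    also have "\<dots> = cmod (mtrace A)" using es(2) n by (simp add: sum_list_triv)
    finally show False using tr by simp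
  qed
  then obtain e where e: "e \<in> set es" "cmod (mtrace A) \<le> real n * cmod e" by blast
  then have "poly (char_poly A) e = 0"
    unfolding es(1) by (auto simp: poly_prod_list prod_list_zero_iff image_iff intro!: bexI[of _ e])
  then have "eigenvalue A e" using eigenvalue_root_char_poly[OF A] by simp
  with e(2) show ?thesis unfolding eigenvalue_def by blast
qed

lemma cinner_cong: "(\<And>i. i < n \<Longrightarrow> v i = v' i) \<Longrightarrow> (\<And>i. i < n \<Longrightarrow> w i = w' i) \<Longrightarrow> cinner n v w = cinner n v' w'"
  by (simp add: cinner_def)

lemma sesq_cong: "(\<And>i j. i < n \<Longrightarrow> j < n \<Longrightarrow> A i j = B i j) \<Longrightarrow> sesq n A v w = sesq n B v w"
  by (simp add: sesq_def)

lemma mapp_scale: "mapp n A (\<lambda>i. c * v i) = (\<lambda>i. c * mapp n A v i)"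
  by (simp add: mapp_def sum_distrib_left mult_ac)

lemma cinner_scale_right: "cinner n v (\<lambda>i. c * w i) = c * cinner n v w"
  by (simp add: cinner_def sum_distrib_left mult_ac)

lemma sesq_unitv_left: "i < n \<Longrightarrow> sesq n A (unitv i) v = mapp n A v i"
  by (simp add: sesq_mapp cinner_def unitv_def if_distrib[where f=cnj] if_distrib[where f="\<lambda>x. x * _"] cong: if_cong)

text \<open>\<open>P Q\<close> need not be Hermitian, but its nonzero eigenvalues are positive: if
  \<open>P Q u = e u\<close> and \<open>y = Q u\<close>, the form of \<open>P\<close> at
  \<open>y\<close> is \<open>e\<close> times the form of \<open>Q\<close> at
  \<open>u\<close>.\<close>

lemma product_eigenvector:
  assumes P: "pos n P" and Q: "pos n Q" and n: "0 < n" and T: "0 < Re (trp n P Q)"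
  obtains p m where "0 < m" "Re (trp n P Q) \<le> real n * m"
    "\<And>i. i < n \<Longrightarrow> mapp n P (mapp n Q p) i = of_real m * p i" "sesq n Q p p = of_real m"
proof -
  define M where "M = mat n n (\<lambda>(i, j). \<Sum>k<n. P i k * Q k j)"
  have M: "M \<in> carrier_mat n n" by (simp add: M_def)
  have "mtrace M = trp n P Q" by (simp add: M_def mtrace_def trp_def)
  then obtain e v where ev: "eigenvector M v e" and "cmod (trp n P Q) \<le> real n * cmod e"
    using large_eigenvalue[OF M n] by metis
  then have e: "Re (trp n P Q) \<le> real n * cmod e" using complex_Re_le_cmod order_trans by blast
  with T n have e0: "0 < cmod e" by (metis less_le_trans mult_pos_pos norm_le_zero_iff not_less of_nat_0_less_iff mult_zero_right norm_zero zero_less_norm_iff less_irrefl)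
  define u where "u = (\<lambda>i. v $ i)"
  have v: "v \<in> carrier_vec n" "v \<noteq> 0\<^sub>v n" "M *\<^sub>v v = e \<cdot>\<^sub>v v"
    using ev M by (auto simp: eigenvector_def)
  have Mu: "mapp n P (mapp n Q u) i = e * u i" if i: "i < n" for i
  proof -
    have "(M *\<^sub>v v) $ i = (\<Sum>j<n. (\<Sum>k<n. P i k * Q k j) * v $ j)"
      using i v(1) by (simp add: M_def scalar_prod_def atLeast0LessThan)
    also have "\<dots> = (\<Sum>j<n. \<Sum>k<n. P i k * (Q k j * v $ j))"
      by (simp add: sum_distrib_right mult.assoc)
    also have "\<dots> = (\<Sum>k<n. \<Sum>j<n. P i k * (Q k j * v $ j))" by (rule sum.swap)
    also have "\<dots> = mapp n P (mapp n Q u) i" by (simp add: mapp_def u_def sum_distrib_left)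
    finally show ?thesis using v(1,3) i by (simp add: u_def)
  qed
  define y where "y = mapp n Q u"
  define s where "s = Re (sesq n Q u u)"
  have s: "sesq n Q u u = of_real s" unfolding s_def by (rule pos_real[OF Q])
  have yu: "cinner n y u = of_real s"
    using s cnj_cinner[of n u y] by (simp add: sesq_mapp y_def)
  have "sesq n P y y = cinner n y (\<lambda>i. e * u i)"
    unfolding sesq_mapp y_def using Mu by (intro cinner_cong) auto
  then have Py: "sesq n P y y = e * of_real s" by (simp add: cinner_scale_right yu)
  \<comment> \<open>If \<open>s = 0\<close>, then \<open>Q u = 0\<close> by positivity, so
    \<open>e u = 0\<close> although \<open>e\<close> and \<open>u\<close> are nonzero.\<close>
  have "s \<noteq> 0"
  proof
    assume "s = 0"
    then have "y i = 0" if "i < n" for i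
      using pos_null[OF Q, of u "unitv i"] s that by (simp add: sesq_unitv_left y_def)
    then have "mapp n P y i = 0" for i by (simp add: mapp_def)
    then have "u i = 0" if "i < n" for i using Mu[OF that] e0 by (simp add: y_def)
    then have "v = 0\<^sub>v n" using v(1) by (intro eq_vecI) (auto simp: u_def)
    with v(2) show False by simp
  qed
  moreover have "s \<ge> 0" using Q by (simp add: s_def pos_def)
  ultimately have s0: "s > 0" by simp
  have "e = of_real (Re (sesq n P y y) / s)"
    using Py pos_real[OF P, of y] s0 by (simp add: field_simps)
  moreover have "0 \<le> Re (sesq n P y y) / s" using P s0 by (simp add: pos_def)
  ultimately have em: "e = of_real (cmod e)" by (metis abs_of_nonneg norm_of_real)
  \<comment> \<open>Normalizes the eigenvector so that the form of \<open>Q\<close> at it equals the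
    eigenvalue.\<close>
  define c where "c = complex_of_real (sqrt (cmod e / s))"
  have c2: "cnj c * c = of_real (cmod e / s)"
    using s0 by (simp add: c_def flip: of_real_mult)
  show ?thesis
  proof
    show "0 < cmod e" by fact
    show "Re (trp n P Q) \<le> real n * cmod e" by fact
    show "mapp n P (mapp n Q (\<lambda>i. c * u i)) i = of_real (cmod e) * (c * u i)" if "i < n" for i
      using Mu[OF that] em by (simp add: mapp_scale)
    have "sesq n Q (\<lambda>i. c * u i) (\<lambda>i. c * u i) = (cnj c * c) * of_real s"
      by (simp add: sesq_scale_left sesq_scale_right s)
    then show "sesq n Q (\<lambda>i. c * u i) (\<lambda>i. c * u i) = of_real (cmod e)"
      unfolding c2 using s0 by simp
  qed
qed

section \<open>Deflation of effects and the slack of the trace inequality\<close>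

lemma pos_cong:
  assumes "\<And>i j. i < n \<Longrightarrow> j < n \<Longrightarrow> A i j = B i j"
  shows "pos n A = pos n B"
  unfolding pos_def using sesq_cong[of n A B, OF assms] by simp

lemma effect_complement: "effect n Q \<Longrightarrow> effect n (idm - Q)"
  by (simp add: effect_def)

text \<open>The upper bound by \<open>idm\<close> survives because something positive is subtracted.
  The norm bound follows from \<open>idm - outer p\<close>, a sum of two positive matrices,
  evaluated at \<open>p\<close> itself.\<close>

lemma effect_deflate:
  assumes A: "effect n A" and w: "sesq n A w w = 1"
    and p: "\<And>i. i < n \<Longrightarrow> mapp n A w i = p i"
  shows "effect n (A - outer p)" and "Re (cinner n p p) \<le> 1"
proof -
  have posA: "pos n A" "pos n (idm - A)" using A by (auto simp: effect_def)
  have 1: "pos n (A - outer p)"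
    using pos_deflate[OF posA(1), of w] w p by (subst pos_cong[where B="A - outer (mapp n A w)"]) (auto simp: outer_def)
  have eq: "idm - (A - outer p) = (idm - A) + outer p" by (auto simp: fun_eq_iff)
  show "effect n (A - outer p)"
    unfolding effect_def eq using 1 pos_add[OF posA(2) pos_outer] by blast
  have "pos n (idm - outer p)"
    using pos_add[OF 1 posA(2)] by (rule back_subst[where P="pos n"]) (auto simp: fun_eq_iff)
  then have "0 \<le> Re (sesq n (idm - outer p) p p)" by (simp add: pos_def)
  moreover have "cinner n p p = of_real (Re (cinner n p p))"
    using pos_real[OF pos_idm, of n p] by (simp add: sesq_idm)
  then obtain a where a: "cinner n p p = of_real a" by blast
  ultimately have "a * a \<le> a" by (simp add: sesq_diff_mat sesq_idm sesq_outer)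
  then show "Re (cinner n p p) \<le> 1" unfolding a
    by (cases "a \<le> 0") (auto simp: not_le)
qed

text \<open>The slack of the trace inequality, kept as one number so that its change under deflation
  can be followed.\<close>

definition tracegap :: "nat \<Rightarrow> (nat \<Rightarrow> nat \<Rightarrow> complex) \<Rightarrow> (nat \<Rightarrow> nat \<Rightarrow> complex) \<Rightarrow> (nat \<Rightarrow> nat \<Rightarrow> complex) \<Rightarrow> real" where
  "tracegap n E P Q = 3 / 2 * Re (trp n P idm) - Re (trp n P Q) - sqrt 2 * (Re (trp n P E) - Re (trp n Q E))"

text \<open>Crude bound from \<open>tr (P E) \<le> tr P\<close> and \<open>sqrt 2 < 3 / 2\<close>.
  It already yields nonnegativity when \<open>tr (P Q) = 0\<close>, the state that deflation
  approaches.\<close>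

lemma tracegap_lower:
  assumes "effect n E" "effect n P" "effect n Q"
  shows "- Re (trp n P Q) \<le> tracegap n E P Q"
proof -
  have "0 \<le> Re (trp n P (idm - E))" "0 \<le> Re (trp n Q E)" "0 \<le> Re (trp n P E)"
    using assms by (auto simp: effect_def intro!: trp_nonneg(1))
  moreover have "sqrt 2 < 3 / 2" by (rule real_less_lsqrt) (auto simp: power2_eq_square)
  then have "sqrt 2 * Re (trp n P E) \<le> 3 / 2 * Re (trp n P E)"
    using \<open>0 \<le> Re (trp n P E)\<close> by (intro mult_right_mono) auto
  moreover have "0 \<le> sqrt 2 * Re (trp n Q E)" using \<open>0 \<le> Re (trp n Q E)\<close> by simp
  ultimately show ?thesis
    unfolding tracegap_def right_diff_distrib trp_diff_right minus_complex.sel by linarith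
qed

text \<open>Removing an eigenvector of \<open>P Q\<close> from both \<open>P\<close> and \<open>Q\<close> splits off a two-dimensional block,
  as in Jordan's lemma for a pair of projections.\<close>

lemma tracegap_deflate:
  assumes E: "effect n E" and P: "effect n P" and Q: "effect n Q"
    and n: "0 < n" and T: "0 < Re (trp n P Q)"
  obtains P' Q' where "effect n P'" "effect n Q'"
    "Re (trp n P' Q') \<le> (1 - 1 / n) * Re (trp n P Q)"
    "tracegap n E P' Q' \<le> tracegap n E P Q"
proof -
  have posP: "pos n P" and posQ: "pos n Q" using P Q by (auto simp: effect_def)
  obtain p m where m: "0 < m" and Tm: "Re (trp n P Q) \<le> real n * m"
    and eig: "\<And>i. i < n \<Longrightarrow> mapp n P (mapp n Q p) i = of_real m * p i"
    and Qpp: "sesq n Q p p = of_real m"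
    using product_eigenvector[OF posP posQ n T] by metis
  define r where "r = complex_of_real (sqrt m)"
  have r: "r \<noteq> 0" "cnj r = r" "r * r = of_real m"
    using m by (auto simp: r_def simp flip: of_real_mult)
  \<comment> \<open>\<open>y\<close> is \<open>Q p\<close> divided by \<open>sqrt m\<close>: the
    vector to remove from \<open>Q\<close>, partner of \<open>p\<close> in the invariant
    block.\<close>
  define y where "y = mapp n Q (\<lambda>i. 1 / r * p i)"
  have y: "y = (\<lambda>i. 1 / r * mapp n Q p i)" unfolding y_def by (rule mapp_scale)
  have pQp: "cinner n p (mapp n Q p) = of_real m" using Qpp by (simp add: sesq_mapp)
  then have Qpp': "cinner n (mapp n Q p) p = of_real m" using cnj_cinner[of n p "mapp n Q p"] by simp
  have py: "cinner n p y = r"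
    unfolding y cinner_scale_right pQp using r by (simp add: field_simps)
  then have yp: "cinner n y p = r" using cnj_cinner[of n p y] r(2) by simp
  have PQp: "sesq n P (mapp n Q p) (mapp n Q p) = of_real (m * m)"
  proof -
    have "sesq n P (mapp n Q p) (mapp n Q p) = cinner n (mapp n Q p) (\<lambda>i. of_real m * p i)"
      unfolding sesq_mapp using eig by (intro cinner_cong) auto
    then show ?thesis by (simp add: cinner_scale_right Qpp')
  qed
  have Pyy: "sesq n P y y = of_real m"
    unfolding y sesq_scale_left sesq_scale_right PQp using r m
    by (simp add: field_simps flip: r(3))
  \<comment> \<open>A preimage of \<open>p\<close> under \<open>P\<close> with form value 1, as
    \<open>effect_deflate\<close> demands.\<close>
  define w where "w = (\<lambda>i. 1 / of_real m * mapp n Q p i)"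
  have w: "sesq n P w w = 1"
    unfolding w_def sesq_scale_left sesq_scale_right PQp using m by simp
  have Pw: "mapp n P w i = p i" if "i < n" for i
    unfolding w_def mapp_scale using eig[OF that] m by simp
  have wQ: "sesq n Q (\<lambda>i. 1 / r * p i) (\<lambda>i. 1 / r * p i) = 1"
    unfolding sesq_scale_left sesq_scale_right Qpp using r m by (simp add: field_simps)
  note defP = effect_deflate[OF P w Pw]
  note defQ = effect_deflate[OF Q wQ, of y, unfolded y_def, OF refl, folded y_def]
  define a where "a = Re (cinner n p p)"
  have a: "cinner n p p = of_real a"
    using pos_real[OF pos_idm, of n p] by (simp add: sesq_idm a_def)
  have ma: "m \<le> a" using effect_le_cinner[OF Q, of p] by (simp add: Qpp a_def)
  have gap: "sqrt 2 * (Re (sesq n E p p) - Re (sesq n E y y)) \<le> 3 / 2 * a - m"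
    using effect_expectation_gap[OF E a _ defQ(2) m ma] py defP(2) by (simp add: a_def r_def)
  \<comment> \<open>Each single subtraction costs \<open>m\<close> and the overlap of
    \<open>p\<close> and \<open>y\<close> gives \<open>m\<close> back, so the net loss is
    \<open>m\<close>, at least the fraction \<open>1 / n\<close> of the trace.\<close>
  have tPQ: "trp n (P - outer p) (Q - outer y) = trp n P Q - of_real m"
    using trp_commute[of n P "outer y"]
    by (simp add: trp_diff_left trp_diff_right trp_outer Pyy Qpp sesq_outer py yp r(3))
  show ?thesis
  proof
    show "effect n (P - outer p)" by (rule defP(1))
    show "effect n (Q - outer y)" by (rule defQ(1))
    have "Re (trp n P Q) / n \<le> m" using Tm n by (simp add: field_simps)
    then show "Re (trp n (P - outer p) (Q - outer y)) \<le> (1 - 1 / n) * Re (trp n P Q)"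
      by (simp add: tPQ algebra_simps)
    show "tracegap n E (P - outer p) (Q - outer y) \<le> tracegap n E P Q"
      using gap
      unfolding tracegap_def tPQ trp_diff_left[of n _ _ idm] trp_diff_left[of n _ _ E] trp_outer sesq_idm a
      by (simp add: algebra_simps diff_divide_distrib)
  qed
qed

text \<open>Deflation shrinks \<open>tr (P Q)\<close>, hence the defect in \<open>tracegap_lower\<close>, geometrically; no induction
  on the rank is needed.\<close>

lemma tracegap_nonneg:
  assumes E: "effect n E" and n: "0 < n" and P: "effect n P" and Q: "effect n Q"
  shows "0 \<le> tracegap n E P Q"
proof -
  have approx: "- ((1 - 1 / n) ^ k * Re (trp n P Q)) \<le> tracegap n E P Q"
    if "effect n P" "effect n Q" for k P Q
    using that
  proof (induction k arbitrary: P Q)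
    case 0
    then show ?case using tracegap_lower[OF E] by simp
  next
    case (Suc k)
    show ?case
    proof (cases "0 < Re (trp n P Q)")
      case True
      from tracegap_deflate[OF E Suc.prems n this] obtain P' Q' where
        PQ': "effect n P'" "effect n Q'" "Re (trp n P' Q') \<le> (1 - 1 / n) * Re (trp n P Q)"
        "tracegap n E P' Q' \<le> tracegap n E P Q" by metis
      have "(1 - 1 / n) ^ k * Re (trp n P' Q') \<le> (1 - 1 / n) ^ k * ((1 - 1 / n) * Re (trp n P Q))"
        using PQ'(3) n by (intro mult_left_mono) auto
      then show ?thesis using Suc.IH[OF PQ'(1,2)] PQ'(4) by (simp add: mult_ac)
    next
      \<comment> \<open>Here the trace of \<open>P Q\<close> is zero, so the crude bound is already
        enough.\<close>
      case False
      moreover have "0 \<le> Re (trp n P Q)"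
        using Suc.prems by (auto simp: effect_def intro!: trp_nonneg(1))
      ultimately show ?thesis using tracegap_lower[OF E Suc.prems] by simp
    qed
  qed
  have "(\<lambda>k. - ((1 - 1 / n) ^ k * Re (trp n P Q))) \<longlonglongrightarrow> - (0 * Re (trp n P Q))"
    using n by (intro tendsto_intros LIMSEQ_power_zero) auto
  then have "- (0 * Re (trp n P Q)) \<le> tracegap n E P Q"
    by (rule LIMSEQ_le_const2) (use approx[OF P Q] in auto)
  then show ?thesis by simp
qed

lemma trace_bell_nonpos:
  assumes n: "0 < n" and \<tau>: "1 / sqrt 2 + 1 / 2 \<le> \<tau>"
    and A: "effect n A0" "effect n A1" and B: "effect n B0" "effect n B1"
    and le: "Re (trp n A0 idm) \<le> Re (trp n B0 idm)"
  shows "Re (trp n A0 B0) + Re (trp n A0 B1) + Re (trp n A1 B0) - Re (trp n A1 B1)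
    - \<tau> * (Re (trp n A0 idm) + Re (trp n B0 idm)) \<le> 0"
proof -
  define a where "a = Re (trp n A0 idm)"
  define b where "b = Re (trp n B0 idm)"
  define s :: real where "s = sqrt 2"
  have s: "s > 0" "s * s = 2" by (auto simp: s_def)
  have "1 / s = s / 2" using s by (simp add: field_simps)
  with \<tau> have \<tau>: "s + 1 \<le> 2 * \<tau>" by (simp add: s_def)
  have s1: "1 \<le> s" by (simp add: s_def)
  have "0 \<le> a" using A pos_idm by (auto simp: a_def effect_def intro: trp_nonneg(1))
  have "trp n idm B0 = trp n B0 idm" by (rule trp_commute)
  with tracegap_nonneg[OF B(2) n A] tracegap_nonneg[OF B(1) n A(1) effect_complement[OF A(2)]]
  have "s * (Re (trp n A0 B1) - Re (trp n A1 B1) + Re (trp n A0 B0) + Re (trp n A1 B0) - b) \<le> 2 * a"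
    by (simp add: tracegap_def trp_diff_left trp_diff_right a_def b_def s_def algebra_simps)
  \<comment> \<open>Since \<open>s * s = 2\<close>, dividing \<open>2 * a\<close> by
    \<open>s\<close> leaves \<open>s * a\<close>.\<close>
  also have "2 * a = s * (s * a)" using s(2) by (simp flip: mult.assoc)
  finally have "Re (trp n A0 B1) - Re (trp n A1 B1) + Re (trp n A0 B0) + Re (trp n A1 B0) - b \<le> s * a"
    using s(1) by simp
  moreover have "s * a + b - \<tau> * (a + b) \<le> 0"
  proof -
    \<comment> \<open>\<open>\<tau> (a + b) - s a - b\<close> is the sum of these two products. The
      first uses \<open>a \<le> b\<close>, the second is where the threshold on
      \<open>\<tau>\<close> enters.\<close>
    have "0 \<le> (\<tau> - 1) * (b - a)" using \<tau> s1 le by (intro mult_nonneg_nonneg) (auto simp: a_def b_def)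
    moreover have "0 \<le> (2 * \<tau> - (s + 1)) * a" using \<tau> \<open>0 \<le> a\<close> by (intro mult_nonneg_nonneg) auto
    ultimately show ?thesis by (simp add: algebra_simps)
  qed
  ultimately show ?thesis unfolding a_def[symmetric] b_def[symmetric] by linarith
qed

section \<open>Quantum behaviours\<close>

definition ent :: "complex mat \<Rightarrow> nat \<Rightarrow> nat \<Rightarrow> complex" where
  "ent M i j = M $$ (i, j)"

lemma psd_iff_pos: "psd n M \<longleftrightarrow> M \<in> carrier_mat n n \<and> pos n (ent M)"
proof -
  have "(\<forall>v \<in> carrier_vec n. let q = (\<Sum>i<n. \<Sum>j<n. cnj (v $ i) * M $$ (i, j) * v $ j) in Im q = 0 \<and> 0 \<le> Re q)
    \<longleftrightarrow> pos n (ent M)" (is "?L \<longleftrightarrow> ?R")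
  proof
    assume L: ?L
    show ?R unfolding pos_def
    proof
      fix v
      have eq: "(\<Sum>i<n. \<Sum>j<n. cnj (vec n v $ i) * M $$ (i, j) * vec n v $ j) = sesq n (ent M) v v"
        by (simp add: sesq_def ent_def)
      from bspec[OF L vec_carrier[of n v]] show "Im (sesq n (ent M) v v) = 0 \<and> 0 \<le> Re (sesq n (ent M) v v)"
        unfolding eq Let_def .
    qed
  qed (simp add: pos_def sesq_def ent_def Let_def)
  then show ?thesis by (simp add: psd_def)
qed

lemma povm2_carrier: "povm2 n M \<Longrightarrow> M 0 \<in> carrier_mat n n \<and> M 1 \<in> carrier_mat n n"
  by (simp add: povm2_def psd_def)

text \<open>Stated entrywise below \<open>n\<close>, since matrix entries out of range are
  unspecified.\<close>

lemma povm2_complement: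
  assumes "povm2 n M" "i < n" "j < n"
  shows "ent (M 1) i j = (idm - ent (M 0)) i j"
proof -
  have "(M 0 + M 1) $$ (i, j) = (1\<^sub>m n :: complex mat) $$ (i, j)" using assms(1) by (simp add: povm2_def)
  then show ?thesis
    using assms povm2_carrier[OF assms(1)] by (auto simp: ent_def idm_def algebra_simps eq_diff_eq)
qed

lemma povm2_effect:
  assumes "povm2 n M"
  shows "effect n (ent (M 0))"
proof -
  have "pos n (ent (M 1)) = pos n (idm - ent (M 0))"
    by (rule pos_cong) (rule povm2_complement[OF assms])
  then show ?thesis using assms unfolding povm2_def psd_iff_pos effect_def by blast
qed

text \<open>The transposed form at \<open>v\<close> is the original form at the conjugate of
  \<open>v\<close>. The transpose arises on Bob's side of the maximally entangled state.\<close>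

lemma pos_transpose:
  assumes "pos n A"
  shows "pos n (\<lambda>i j. A j i)"
proof -
  have "sesq n (\<lambda>i j. A j i) v v = sesq n A (\<lambda>i. cnj (v i)) (\<lambda>i. cnj (v i))" for v
    unfolding sesq_def by (subst sum.swap) (simp add: mult_ac)
  with assms show ?thesis by (simp add: pos_def)
qed

lemma effect_transpose:
  assumes "effect n A"
  shows "effect n (\<lambda>i j. A j i)"
proof -
  have "idm - (\<lambda>i j. A j i) = (\<lambda>i j. (idm - A) j i)" by (auto simp: fun_eq_iff idm_def)
  then show ?thesis using assms pos_transpose[of n A] pos_transpose[of n "idm - A"] by (simp add: effect_def)
qed

definition tens :: "nat \<Rightarrow> (nat \<Rightarrow> nat \<Rightarrow> complex) \<Rightarrow> (nat \<Rightarrow> nat \<Rightarrow> complex) \<Rightarrow> nat \<Rightarrow> nat \<Rightarrow> complex" where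
  "tens m A B i j = A (i div m) (j div m) * B (i mod m) (j mod m)"

lemma mtrace_tensor:
  assumes "\<rho> \<in> carrier_mat (n * m) (n * m)" "A \<in> carrier_mat n n" "B \<in> carrier_mat m m"
  shows "mtrace (\<rho> * tensor A B) = trp (n * m) (ent \<rho>) (tens m (ent A) (ent B))"
proof -
  have T: "tensor A B \<in> carrier_mat (n * m) (n * m)" using assms by (simp add: tensor_def)
  show ?thesis unfolding mtrace_mult[OF assms(1) T]
    using assms by (intro trp_cong) (auto simp: ent_def tens_def tensor_def)
qed

lemma div_mod_less: "k < n * m \<Longrightarrow> k div m < n \<and> k mod m < (m::nat)"
  by (cases "m = 0") (auto simp: less_mult_imp_div_less)

lemma tens_cong:
  assumes "i < n * m" "j < n * m"
    and "\<And>i j. i < n \<Longrightarrow> j < n \<Longrightarrow> A i j = A' i j" "\<And>i j. i < m \<Longrightarrow> j < m \<Longrightarrow> B i j = B' i j"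
  shows "tens m A B i j = tens m A' B' i j"
  using assms div_mod_less[OF assms(1)] div_mod_less[OF assms(2)] by (simp add: tens_def)

lemma sesq_sum: "sesq n (\<lambda>i j. \<Sum>k\<in>K. F k i j) v w = (\<Sum>k\<in>K. sesq n (F k) v w)"
proof (induction K rule: infinite_finite_induct)
  case (insert x K)
  then show ?case using sesq_add_mat[of n "F x" "\<lambda>i j. \<Sum>k\<in>K. F k i j" v w] by (simp add: plus_fun_def)
qed (simp_all add: sesq_def)

lemma pos_sum: "(\<And>k. k \<in> K \<Longrightarrow> pos n (F k)) \<Longrightarrow> pos n (\<lambda>i j. \<Sum>k\<in>K. F k i j)"
  by (auto simp: pos_def sesq_sum intro!: sum_nonneg)

lemma tens_outer: "tens m (outer v) (outer w) = outer (\<lambda>i. v (i div m) * w (i mod m))"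
  by (auto simp: fun_eq_iff tens_def outer_def)

text \<open>Decompose both factors: the tensor product of rank-one matrices is the rank-one matrix
  of the product vector.\<close>

lemma pos_tens:
  assumes "pos n A" "pos m B"
  shows "pos (n * m) (tens m A B)"
proof -
  obtain k :: nat and vs where vs: "\<forall>i<n. \<forall>j<n. A i j = (\<Sum>a<k. outer (vs a) i j)"
    using pos_sum_outer[OF assms(1)] by blast
  obtain l :: nat and ws where ws: "\<forall>i<m. \<forall>j<m. B i j = (\<Sum>b<l. outer (ws b) i j)"
    using pos_sum_outer[OF assms(2)] by blast
  have "pos (n * m) (\<lambda>i j. \<Sum>a<k. \<Sum>b<l. tens m (outer (vs a)) (outer (ws b)) i j)"
    unfolding tens_outer by (intro pos_sum pos_outer)
  moreover have "tens m A B i j = (\<Sum>a<k. \<Sum>b<l. tens m (outer (vs a)) (outer (ws b)) i j)"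
    if "i < n * m" "j < n * m" for i j
    using div_mod_less[OF that(1)] div_mod_less[OF that(2)] vs ws by (simp add: tens_def sum_product)
  ultimately show ?thesis by (subst pos_cong)
qed

lemma tens_idm: "tens m idm idm = idm"
proof (intro ext)
  fix i j
  have "i = j \<longleftrightarrow> i div m = j div m \<and> i mod m = j mod m" by (metis div_mult_mod_eq)
  then show "tens m idm idm i j = idm i j" by (simp add: tens_def idm_def)
qed

lemma tens_diff_left: "tens m (A - A') B = tens m A B - tens m A' B"
  by (auto simp: fun_eq_iff tens_def algebra_simps)

lemma tens_diff_right: "tens m A (B - B') = tens m A B - tens m A B'"
  by (auto simp: fun_eq_iff tens_def algebra_simps)

section \<open>Boundedness of the quantum values\<close>

lemma qprob_nonneg:
  assumes "density (n * m) \<rho>" "psd n (A x a)" "psd m (B y b)"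
  shows "0 \<le> qprob \<rho> A B a b x y"
proof -
  have "mtrace (\<rho> * tensor (A x a) (B y b)) = trp (n * m) (ent \<rho>) (tens m (ent (A x a)) (ent (B y b)))"
    using assms by (intro mtrace_tensor) (auto simp: density_def psd_iff_pos)
  then show ?thesis
    using assms unfolding qprob_def density_def psd_iff_pos by (simp add: trp_nonneg(1) pos_tens)
qed

text \<open>The chain \<open>A \<otimes> B \<le> A \<otimes> 1 \<le> 1 \<otimes> 1\<close>, paired
  with a state of trace one.\<close>

lemma qprob_le_1:
  assumes \<rho>: "density (n * m) \<rho>" and A: "povm2 n (A x)" and B: "povm2 m (B y)"
  shows "qprob \<rho> A B 0 0 x y \<le> 1"
proof -
  have pos: "pos (n * m) (ent \<rho>)" and car: "\<rho> \<in> carrier_mat (n * m) (n * m)"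
    using \<rho> by (auto simp: density_def psd_iff_pos)
  note EA = povm2_effect[OF A, unfolded effect_def] and EB = povm2_effect[OF B, unfolded effect_def]
  let ?t = "\<lambda>X Y. Re (trp (n * m) (ent \<rho>) (tens m X Y))"
  have "0 \<le> ?t (ent (A x 0)) (idm - ent (B y 0))" "0 \<le> ?t (idm - ent (A x 0)) idm"
    using pos EA EB by (auto intro!: trp_nonneg pos_tens pos_idm)
  then have "?t (ent (A x 0)) (ent (B y 0)) \<le> Re (trp (n * m) (ent \<rho>) idm)"
    by (simp add: tens_diff_left tens_diff_right trp_diff_right tens_idm)
  also have "trp (n * m) (ent \<rho>) idm = mtrace \<rho>"
    using car by (simp add: trp_def mtrace_def ent_def idm_def if_distrib[where f="\<lambda>x. _ * x"] cong: if_cong)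
  also have "\<dots> = 1" using \<rho> by (simp add: density_def)
  finally show ?thesis
    using car povm2_carrier[OF A] povm2_carrier[OF B] by (simp add: qprob_def mtrace_tensor)
qed

text \<open>For \<open>\<tau> \<ge> 1\<close> only \<open>p(0,0|0,0)\<close> has a positive
  coefficient. Boundedness is what makes \<open>SQ\<close> an upper bound of the values.\<close>

lemma bdd_above_quantum_values:
  assumes "1 \<le> \<tau>"
  shows "bdd_above (quantum_values \<tau>)"
proof (rule bdd_aboveI[of _ 1])
  fix S assume "S \<in> quantum_values \<tau>"
  then obtain n m \<rho> A B where S: "S = bellS \<tau> (qprob \<rho> A B)" and \<rho>: "density (n * m) \<rho>"
    and A: "povm2 n (A 0)" "povm2 n (A 1)" and B: "povm2 m (B 0)" "povm2 m (B 1)"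
    unfolding quantum_values_def by blast
  have psd: "psd n (A x a) \<and> psd m (B x a)" if "x \<in> {0, 1}" "a \<in> {0, 1}" for x a
    using that A B by (auto simp: povm2_def)
  have nonneg: "0 \<le> qprob \<rho> A B a b x y" if "x \<in> {0, 1}" "a \<in> {0, 1}" "y \<in> {0, 1}" "b \<in> {0, 1}" for a b x y
    using psd[OF that(1,2)] psd[OF that(3,4)] by (intro qprob_nonneg[OF \<rho>]) auto
  have "(1 - \<tau>) * (qprob \<rho> A B 0 0 0 1 + qprob \<rho> A B 0 0 1 0) \<le> 0"
    using assms nonneg by (intro mult_nonpos_nonneg) auto
  moreover have "0 \<le> \<tau> * (qprob \<rho> A B 0 1 0 1 + qprob \<rho> A B 1 0 1 0)"
    using assms nonneg by (intro mult_nonneg_nonneg) auto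
  ultimately show "S \<le> 1"
    using qprob_le_1[of n m \<rho> A 0 B 0, OF \<rho> A(1) B(1)] nonneg[of 1 0 1 0] unfolding S bellS_def by simp
qed

section \<open>A two-qubit violation\<close>

lemma psd_outer: "psd n (mat n n (\<lambda>(i, j). outer v i j))"
proof -
  have "pos n (ent (mat n n (\<lambda>(i, j). outer v i j))) = pos n (outer v)"
    by (rule pos_cong) (simp add: ent_def)
  then show ?thesis by (simp add: psd_iff_pos pos_outer)
qed

lemma quantum_violation:
  assumes \<tau>: "1 / 2 \<le> \<tau>" "\<tau> < 3 / 2"
  shows "\<exists>S\<in>quantum_values \<tau>. 0 < S"
proof -
  \<comment> \<open>\<open>C\<close> is the squared cosine of the angle, chosen midway between
    \<open>\<tau> - 1 / 2\<close> and 1; \<open>x\<close> is minus the squared tangent and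
    \<open>N\<close> the squared norm of the state.\<close>
  define C where "C = (\<tau> + 1 / 2) / 2"
  have C: "0 < C" "C < 1" "\<tau> - 1 / 2 < C" using \<tau> by (auto simp: C_def)
  define x where "x = - (1 - C) / C"
  define N where "N = 1 + x\<^sup>2"
  have N: "N > 0" by (simp add: N_def add_pos_nonneg)
  \<comment> \<open>Indices 0 and 3 encode \<open>|00>\<close> and \<open>|11>\<close>.\<close>
  define r where "r k = (if k = 0 then x else if k = 3 then 1 else 0) / sqrt N" for k :: nat
  define \<psi> where "\<psi> k = complex_of_real (r k)" for k
  define \<rho> where "\<rho> = mat 4 4 (\<lambda>(i, j). outer \<psi> i j)"
  \<comment> \<open>Real orthonormal bases: the standard one for setting 0, a rotated one for
    setting 1. Both parties use the same measurements.\<close>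
  define W :: "nat \<Rightarrow> nat \<Rightarrow> nat \<Rightarrow> real" where
    "W z a i = (if z = 0 then (if i = a then 1 else 0)
      else if a = 0 then (if i = 0 then sqrt C else sqrt (1 - C))
      else (if i = 0 then - sqrt (1 - C) else sqrt C))" for z a i
  define A where "A z a = mat 2 2 (\<lambda>(i, j). outer (\<lambda>i. of_real (W z a i)) i j)" for z a
  have povm: "povm2 2 (A z)" for z
    unfolding povm2_def
  proof (intro conjI)
    show "psd 2 (A z 0)" "psd 2 (A z 1)" unfolding A_def by (rule psd_outer)+
    show "A z 0 + A z 1 = 1\<^sub>m 2"
    proof (rule eq_matI)
      fix i j assume ij: "i < dim_row (1\<^sub>m 2 :: complex mat)" "j < dim_col (1\<^sub>m 2 :: complex mat)"
      have "W z 0 i * W z 0 j + W z 1 i * W z 1 j = (if i = j then 1 else 0)"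
        using ij C by (auto simp: W_def less_2_cases_iff)
      then show "(A z 0 + A z 1) $$ (i, j) = 1\<^sub>m 2 $$ (i, j)"
        using ij by (simp add: A_def outer_def flip: of_real_mult of_real_add)
    qed (simp_all add: A_def)
  qed
  have four: "{..<4} = {0, 1, 2, 3 :: nat}" by auto
  have "mtrace \<rho> = of_real (\<Sum>k<4. r k * r k)"
    by (simp add: mtrace_def \<rho>_def outer_def \<psi>_def)
  also have "(\<Sum>k<4. r k * r k) = (x\<^sup>2 + 1) / N"
    using N by (simp add: r_def four add_divide_distrib power2_eq_square)
  also have "x\<^sup>2 + 1 = N" by (simp add: N_def)
  also have "N / N = 1" using N by simp
  finally have "mtrace \<rho> = 1" by simp
  then have dens: "density (2 * 2) \<rho>" by (simp add: density_def \<rho>_def psd_outer)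
  \<comment> \<open>State and effects are all rank one, so each probability is the squared overlap
    of the state with a product vector.\<close>
  have q: "qprob \<rho> A A a b z y = (x * W z a 0 * W y b 0 + W z a 1 * W y b 1)\<^sup>2 / N" for a b z y
  proof -
    let ?v = "\<lambda>i. complex_of_real (W z a i)" and ?w = "\<lambda>i. complex_of_real (W y b i)"
    let ?r = "(x * W z a 0 * W y b 0 + W z a 1 * W y b 1) / sqrt N"
    have "mtrace (\<rho> * tensor (A z a) (A y b)) = trp (2 * 2) (ent \<rho>) (tens 2 (ent (A z a)) (ent (A y b)))"
      by (rule mtrace_tensor) (simp_all add: \<rho>_def A_def)
    also have "\<dots> = trp (2 * 2) (outer \<psi>) (tens 2 (outer ?v) (outer ?w))"
      by (intro trp_cong tens_cong[where n=2]) (simp_all add: \<rho>_def A_def ent_def)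
    also have "\<dots> = cinner 4 \<psi> (\<lambda>i. ?v (i div 2) * ?w (i mod 2)) * cinner 4 (\<lambda>i. ?v (i div 2) * ?w (i mod 2)) \<psi>"
      by (simp add: tens_outer trp_outer sesq_outer)
    also have "cinner 4 \<psi> (\<lambda>i. ?v (i div 2) * ?w (i mod 2)) = of_real ?r"
      by (simp add: cinner_def \<psi>_def r_def four add_divide_distrib)
    also have "cinner 4 (\<lambda>i. ?v (i div 2) * ?w (i mod 2)) \<psi> = of_real ?r"
      by (simp add: cinner_def \<psi>_def r_def four add_divide_distrib)
    finally have "qprob \<rho> A A a b z y = ?r * ?r"
      by (simp only: qprob_def Re_complex_of_real flip: of_real_mult)
    also have "\<dots> = ?r\<^sup>2" by (simp only: power2_eq_square)
    also have "\<dots> = (x * W z a 0 * W y b 0 + W z a 1 * W y b 1)\<^sup>2 / N"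
      using N by (simp add: power_divide)
    finally show ?thesis .
  qed
  \<comment> \<open>The choice of \<open>x\<close> makes \<open>p(0,0|1,1)\<close> vanish.\<close>
  have orth: "x * sqrt C * sqrt C + sqrt (1 - C) * sqrt (1 - C) = 0"
    using C by (simp add: mult.assoc x_def)
  have "bellS \<tau> (qprob \<rho> A A) = x\<^sup>2 * (1 + 2 * C - 2 * \<tau>) / N"
  proof -
    have e: "qprob \<rho> A A 0 0 0 0 = x\<^sup>2 / N" "qprob \<rho> A A 0 0 1 1 = 0"
      "qprob \<rho> A A 0 0 0 1 = x\<^sup>2 * C / N" "qprob \<rho> A A 0 0 1 0 = x\<^sup>2 * C / N"
      "qprob \<rho> A A 0 1 0 1 = x\<^sup>2 * (1 - C) / N" "qprob \<rho> A A 1 0 1 0 = x\<^sup>2 * (1 - C) / N"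
      unfolding q using C orth
      by (simp_all add: W_def power_mult_distrib)
    show ?thesis unfolding bellS_def e by (simp add: algebra_simps add_divide_distrib diff_divide_distrib)
  qed
  moreover have "0 < x\<^sup>2 * (1 + 2 * C - 2 * \<tau>) / N"
    using C N by (intro divide_pos_pos mult_pos_pos) (auto simp: x_def)
  moreover have "bellS \<tau> (qprob \<rho> A A) \<in> quantum_values \<tau>"
  proof -
    have "bellS \<tau> (qprob \<rho> A A) = bellS \<tau> (qprob \<rho> A A) \<and> 0 < (2::nat) \<and> 0 < (2::nat) \<and> density (2 * 2) \<rho> \<and>
      povm2 2 (A 0) \<and> povm2 2 (A 1) \<and> povm2 2 (A 0) \<and> povm2 2 (A 1)"
      using dens povm by simp
    then show ?thesis unfolding quantum_values_def by blast
  qed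
  ultimately show ?thesis by auto
qed

lemma SQ_pos:
  assumes "1 \<le> \<tau>" "\<tau> < 3 / 2"
  shows "0 < SQ \<tau>"
proof -
  obtain S where "S \<in> quantum_values \<tau>" "0 < S" using quantum_violation[of \<tau>] assms by auto
  then show ?thesis
    unfolding SQ_def using cSup_upper[OF _ bdd_above_quantum_values[OF assms(1)]] by (meson less_le_trans)
qed

section \<open>The maximally entangled state\<close>

lemma mult_add_less: "i < n \<Longrightarrow> j < m \<Longrightarrow> i * m + j < n * (m::nat)"
  using mult_le_mono1[of "Suc i" n m] by simp

lemma sum_mult_lessThan: "(\<Sum>k<n * m. f k) = (\<Sum>i<n. \<Sum>j<m. f (i * m + j :: nat))"
proof -
  have "sum f {i * m..<i * m + m} = (\<Sum>j<m. f (i * m + j))" for i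
    using sum.shift_bounds_nat_ivl[of f 0 "i * m" m] by (simp add: atLeast0LessThan add.commute)
  then show ?thesis using sum.nat_group[of f m n] by simp
qed

text \<open>The state has entries \<open>1 / d\<close> exactly between diagonal index pairs, so the
  fourfold sum collapses to a trace against the transpose of Bob's effect.\<close>

lemma qprob_maxent:
  assumes A: "A x a \<in> carrier_mat d d" and B: "B y b \<in> carrier_mat d d"
  shows "qprob (maxent_rho d) A B a b x y = Re (trp d (ent (A x a)) (\<lambda>i j. ent (B y b) j i)) / d"
proof -
  have \<rho>: "ent (maxent_rho d) (i * d + j) (k * d + l) = (if i = j \<and> k = l then 1 / of_nat d else 0)"
    if "i < d" "j < d" "k < d" "l < d" for i j k l
  proof -
    have "i * d + j < d * d" "k * d + l < d * d"
      using that by (auto intro: mult_add_less)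
    then show ?thesis using that
      by (simp add: ent_def maxent_rho_def maxent_vec_def flip: of_real_mult)
  qed
  have "mtrace (maxent_rho d * tensor (A x a) (B y b)) = trp (d * d) (ent (maxent_rho d)) (tens d (ent (A x a)) (ent (B y b)))"
    by (rule mtrace_tensor) (simp_all add: A B maxent_rho_def)
  also have "\<dots> = (\<Sum>i<d. \<Sum>j<d. \<Sum>k<d. \<Sum>l<d. (if i = j \<and> k = l then 1 / of_nat d else 0) * (ent (A x a) k i * ent (B y b) l j))"
    unfolding trp_def sum_mult_lessThan by (intro sum.cong refl) (simp add: \<rho> tens_def)
  also have "\<dots> = (\<Sum>i<d. \<Sum>k<d. 1 / of_nat d * (ent (A x a) k i * ent (B y b) k i))"
  proof (rule sum.cong[OF refl])
    fix i assume i: "i \<in> {..<d}"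
    have "(\<Sum>l<d. (if i = j \<and> k = l then 1 / of_nat d else 0) * (ent (A x a) k i * ent (B y b) l j))
      = (if i = j then 1 / of_nat d * (ent (A x a) k i * ent (B y b) k j) else 0)" if "k < d" for j k
      using that by (cases "i = j") (simp_all add: if_distrib[where f="\<lambda>x. x * _"] cong: if_cong)
    then have "(\<Sum>j<d. \<Sum>k<d. \<Sum>l<d. (if i = j \<and> k = l then 1 / of_nat d else 0) * (ent (A x a) k i * ent (B y b) l j))
      = (\<Sum>j<d. \<Sum>k<d. if i = j then 1 / of_nat d * (ent (A x a) k i * ent (B y b) k j) else 0)"
      by (intro sum.cong refl) simp
    also have "\<dots> = (\<Sum>k<d. \<Sum>j<d. if i = j then 1 / of_nat d * (ent (A x a) k i * ent (B y b) k j) else 0)"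
      by (rule sum.swap)
    also have "\<dots> = (\<Sum>k<d. 1 / of_nat d * (ent (A x a) k i * ent (B y b) k i))"
      using i by (intro sum.cong refl) simp
    finally show "(\<Sum>j<d. \<Sum>k<d. \<Sum>l<d. (if i = j \<and> k = l then 1 / of_nat d else 0) * (ent (A x a) k i * ent (B y b) l j))
      = (\<Sum>k<d. 1 / of_nat d * (ent (A x a) k i * ent (B y b) k i))" .
  qed
  also have "\<dots> = 1 / of_nat d * trp d (ent (A x a)) (\<lambda>i j. ent (B y b) j i)"
    unfolding trp_def sum_distrib_left by (rule sum.swap)
  also have "\<dots> = trp d (ent (A x a)) (\<lambda>i j. ent (B y b) j i) / of_nat d" by simp
  finally show ?thesis by (simp add: qprob_def)
qed

lemma maxent_bell_nonpos:
  assumes \<tau>: "1 / sqrt 2 + 1 / 2 \<le> \<tau>" and d: "0 < d"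
    and A: "povm2 d (A 0)" "povm2 d (A 1)" and B: "povm2 d (B 0)" "povm2 d (B 1)"
  shows "bellS \<tau> (qprob (maxent_rho d) A B) \<le> 0"
proof -
  define a where "a x = ent (A x 0)" for x
  define b where "b y = (\<lambda>i j. ent (B y 0) j i)" for y
  have EA: "effect d (a 0)" "effect d (a 1)"
    using A by (auto simp: a_def intro: povm2_effect)
  have EB: "effect d (b 0)" "effect d (b 1)"
    using B by (auto simp: b_def intro: effect_transpose povm2_effect)
  define t where "t X Y = Re (trp d X Y)" for X Y
  have t_commute: "t X Y = t Y X" for X Y unfolding t_def by (subst trp_commute) (rule refl)
  have q0: "qprob (maxent_rho d) A B 0 0 x y = t (a x) (b y) / d" if "x \<in> {0, 1}" "y \<in> {0, 1}" for x y
    using that povm2_carrier[OF A(1)] povm2_carrier[OF A(2)] povm2_carrier[OF B(1)] povm2_carrier[OF B(2)]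
    by (subst qprob_maxent) (auto simp: t_def a_def b_def)
  \<comment> \<open>Outcome 1 is replaced by the complement of outcome 0, so that only four effects
    remain.\<close>
  have q01: "qprob (maxent_rho d) A B 0 1 0 1 = (t (a 0) idm - t (a 0) (b 1)) / d"
  proof -
    have "trp d (ent (A 0 0)) (\<lambda>i j. ent (B 1 1) j i) = trp d (a 0) (idm - b 1)"
      using povm2_complement[OF B(2)] by (intro trp_cong) (auto simp: a_def b_def idm_def)
    then show ?thesis
      using povm2_carrier[OF A(1)] povm2_carrier[OF B(2)] by (simp add: qprob_maxent trp_diff_right t_def)
  qed
  have q10: "qprob (maxent_rho d) A B 1 0 1 0 = (t (b 0) idm - t (a 1) (b 0)) / d"
  proof -
    have "trp d (ent (A 1 1)) (\<lambda>i j. ent (B 0 0) j i) = trp d (idm - a 1) (b 0)"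
      using povm2_complement[OF A(2)] by (intro trp_cong) (auto simp: a_def b_def)
    then show ?thesis
      using povm2_carrier[OF A(2)] povm2_carrier[OF B(1)] by (simp add: qprob_maxent trp_diff_left t_def trp_commute[of d idm])
  qed
  have S: "bellS \<tau> (qprob (maxent_rho d) A B) =
      (t (a 0) (b 0) + t (a 0) (b 1) + t (a 1) (b 0) - t (a 1) (b 1) - \<tau> * (t (a 0) idm + t (b 0) idm)) / d"
    unfolding bellS_def q01 q10 by (simp add: q0 add_divide_distrib diff_divide_distrib algebra_simps)
  have "t (a 0) (b 0) + t (a 0) (b 1) + t (a 1) (b 0) - t (a 1) (b 1) - \<tau> * (t (a 0) idm + t (b 0) idm) \<le> 0"
  \<comment> \<open>The expression is symmetric under exchange of the parties, so the effect of
    smaller trace may play the role of \<open>A0\<close>.\<close>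
  proof (cases "t (a 0) idm \<le> t (b 0) idm")
    case True
    then show ?thesis using trace_bell_nonpos[OF d \<tau> EA EB] by (simp add: t_def)
  next
    case False
    then have "t (b 0) (a 0) + t (b 0) (a 1) + t (b 1) (a 0) - t (b 1) (a 1) - \<tau> * (t (b 0) idm + t (a 0) idm) \<le> 0"
      using trace_bell_nonpos[OF d \<tau> EB EA] by (simp add: t_def)
    then show ?thesis by (simp add: t_commute[of "b _" "a _"] add_ac)
  qed
  then show ?thesis unfolding S using d by (simp add: divide_nonpos_pos)
qed

theorem theorem1:
  fixes \<tau> :: real and d :: nat and A B :: "nat \<Rightarrow> nat \<Rightarrow> complex mat"
  assumes "1 / sqrt 2 + 1 / 2 \<le> \<tau>" and "\<tau> < 3 / 2"
    and "0 < d"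
    and "povm2 d (A 0)" and "povm2 d (A 1)" and "povm2 d (B 0)" and "povm2 d (B 1)"
  shows "bellS \<tau> (qprob (maxent_rho d) A B) \<noteq> SQ \<tau>"
proof -
  \<comment> \<open>The threshold exceeds 1, which brings \<open>\<tau>\<close> into the range where
    the supremum is known to be positive.\<close>
  have "sqrt 2 \<le> 2" by (rule real_le_lsqrt) auto
  then have "1 / 2 \<le> 1 / sqrt 2" by (intro divide_left_mono) auto
  with assms(1) have "1 \<le> \<tau>" by linarith
  then have "0 < SQ \<tau>" using assms(2) by (rule SQ_pos)
  with maxent_bell_nonpos[OF assms(1,3-7)] show ?thesis by simp
qed

end
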